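(* Let $0 < \delta < \frac{1}{e}$. Let the sequence $(\lambda_n)_{n\ge 1}$ be chosen randomly from the product space $\left(\frac1e-\delta,\frac1e+\delta\right)^{\mathbb{N}}$ equipped with the product measure of the uniform probability distributions on $\left(\frac1e-\delta,\frac1e+\delta\right)$. Then for almost every sequence $(\lambda_n)$ we have $J(\lambda_n)=\mathbb{C}$.
   Context: For a bounded sequence $(\lambda_n)_{n\ge1}$ of positive real numbers put $f_{\lambda_n}(z)=\lambda_n e^z$ for $z\in\mathbb{C}$, and $F_n=f_{\lambda_n}\circ f_{\lambda_{n-1}}\circ\dots\circ f_{\lambda_1}$. The Fatou set $F(\lambda_n)$ is the set of all $z\in\mathbb{C}$ having an open neighbourhood on which the family $(F_n)_{n\ge 1}$ is normal, i.e. every sequence of members of the family has a subsequence converging almost uniformly (locally uniformly; as usual for normal families, convergence to $\infty$ is allowed). The Julia set is $J(\lambda_n)=\mathbb{C}\setminus F(\lambda_n)$. *)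

theory Defs
  imports "HOL-Probability.Probability"
begin

definition expmap :: "real \<Rightarrow> complex \<Rightarrow> complex"
  where "expmap c z = of_real c * exp z"

(* Sequences are indexed from 1; the value lam 0 is never used. *)
fun compexp :: "(nat \<Rightarrow> real) \<Rightarrow> nat \<Rightarrow> complex \<Rightarrow> complex"
  where
    "compexp lam 0 = id"
  | "compexp lam (Suc n) = expmap (lam (Suc n)) \<circ> compexp lam n"

definition loc_uniform_conv_on ::
    "complex set \<Rightarrow> (nat \<Rightarrow> complex \<Rightarrow> complex) \<Rightarrow> (complex \<Rightarrow> complex) \<Rightarrow> bool"
  where "loc_uniform_conv_on U s g \<longleftrightarrow>
    (\<forall>K. compact K \<and> K \<subseteq> U \<longrightarrow> uniform_limit K s g sequentially)"

definition loc_uniform_conv_infinity_on ::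
    "complex set \<Rightarrow> (nat \<Rightarrow> complex \<Rightarrow> complex) \<Rightarrow> bool"
  where "loc_uniform_conv_infinity_on U s \<longleftrightarrow>
    (\<forall>K. compact K \<and> K \<subseteq> U \<longrightarrow>
      (\<forall>B. eventually (\<lambda>n. \<forall>z\<in>K. B < cmod (s n z)) sequentially))"

(* The limit is either finite-valued or identically infinity. For holomorphic functions on a
   connected U this is the same as locally uniform convergence into the Riemann sphere; the Fatou
   set asks only for some neighbourhood U, which can be shrunk to a disc. *)
definition normal_family_on :: "complex set \<Rightarrow> (complex \<Rightarrow> complex) set \<Rightarrow> bool"
  where "normal_family_on U \<F> \<longleftrightarrow>
    (\<forall>s :: nat \<Rightarrow> complex \<Rightarrow> complex. range s \<subseteq> \<F> \<longrightarrow>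
      (\<exists>r :: nat \<Rightarrow> nat. strict_mono r \<and>
        ((\<exists>g. loc_uniform_conv_on U (s \<circ> r) g) \<or> loc_uniform_conv_infinity_on U (s \<circ> r))))"

definition fatou_set :: "(nat \<Rightarrow> real) \<Rightarrow> complex set"
  where "fatou_set lam =
    {z. \<exists>U. open U \<and> z \<in> U \<and> normal_family_on U {compexp lam n | n. n \<ge> 1}}"

definition julia_set :: "(nat \<Rightarrow> real) \<Rightarrow> complex set"
  where "julia_set lam = UNIV - fatou_set lam"

end

(* Almost surely there are arbitrarily long runs of parameters above 1/e + delta/2. During such a
   run a real orbit moves to the right by a fixed amount in each step, until it is so large that no
   admissible parameters can stop it; hence Re (F_n z) tends to infinity as soon as Im (F_n z)
   tends to 0. If this happened for a point of the Fatou set, then F_n would tend to infinity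
   locally uniformly near it and the derivatives F_n' would tend to infinity, so that the image
   under F_n of a small disc would not fit into a strip of height 4 pi. It would then contain a
   point with imaginary part an odd multiple of pi, whose orbit is bounded two steps later.

   So in a disc D of the Fatou set no orbit meets the real axis, and each F_n maps D into a
   half-plane. By Schwarz-Pick, |F_n'| / |Im F_n| is bounded at the centre. Since
   |Im F_(n+1)| = |F_(n+1)| |sin (Im F_n)|, one step multiplies this quotient by
   |y| / |sin y| >= 1 for y = Im F_n. It therefore converges, the factors tend to 1, and
   Im F_n tends to 0, which was just excluded. *)
theory Submission
  imports Defs "HOL-Complex_Analysis.Complex_Analysis" "HOL-Real_Asymp.Real_Asymp"
begin

section \<open>Infinitely many long runs in a random sequence\<close>

text \<open>The tail unions decrease to the limsup event and each has probability at least
  \<open>p\<close>, so the limsup has positive probability; Borel's zero-one law raises this to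
  1.\<close>

lemma (in prob_space) AE_infinitely_often_indep_events:
  fixes P :: "nat \<Rightarrow> 'a \<Rightarrow> bool"
  assumes indep: "indep_events (\<lambda>m. {x\<in>space M. P m x}) UNIV"
    and p: "0 < p" "\<And>m. p \<le> prob {x\<in>space M. P m x}"
  shows "AE x in M. infinite {m. P m x}"
proof -
  let ?F = "\<lambda>m. {x\<in>space M. P m x}"
  let ?Q = "\<lambda>n. \<Union>m\<in>{n..}. ?F m"
  have [measurable]: "\<And>m. ?F m \<in> sets M"
    using indep by (auto simp: indep_events_def)
  have "(\<lambda>n. prob (?Q n)) \<longlonglongrightarrow> prob (\<Inter>n. ?Q n)"
    by (rule finite_Lim_measure_decseq) (auto simp: decseq_def intro: order_trans)
  moreover have "p \<le> prob (?Q n)" for n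
    using p(2)[of n] by (rule order_trans) (auto intro!: finite_measure_mono)
  ultimately have "p \<le> prob (\<Inter>n. ?Q n)"
    by (intro LIMSEQ_le_const) auto
  then have "prob (\<Inter>n. ?Q n) = 1"
    using borel_0_1_law[OF indep] p(1) by auto
  then show ?thesis
    by (simp add: prob_eq_1) (simp add: Bex_def infinite_nat_iff_unbounded_le)
qed

text \<open>Disjoint blocks of coordinates of equal length give independent events of equal positive
  probability, so infinitely many of them occur almost surely; the countably many \<open>K\<close>
  share one null set.\<close>

lemma AE_PiM_infinitely_many_runs:
  fixes N :: "'a measure"
  assumes N: "prob_space N" and A: "A \<in> sets N" "measure N A > 0"
  shows "AE x in (\<Pi>\<^sub>M n\<in>{1::nat..}. N). \<forall>K. infinite {n. \<forall>i\<in>{n+1..n+K}. x i \<in> A}"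
proof -
  let ?M = "\<Pi>\<^sub>M n\<in>{1::nat..}. N"
  interpret N: prob_space N by fact
  interpret product_prob_space "\<lambda>_::nat. N" "{1..}" by unfold_locales
  have "AE x in ?M. infinite {n. \<forall>i\<in>{n+1..n+K}. x i \<in> A}" for K
  proof -
    \<comment> \<open>The blocks tile \<open>{1..}\<close>. Length \<open>Suc K\<close> instead of
      \<open>K\<close> keeps them nonempty for \<open>K = 0\<close>, so that different
      \<open>m\<close> still give different starting points.\<close>
    define I where "I m = {m * Suc K + 1..m * Suc K + Suc K}" for m
    have I_disj: "disjoint_family I"
    proof -
      have "(i - 1) div Suc K = m" if "i \<in> I m" for i m
        using that unfolding I_def by (intro div_nat_eqI) (simp_all add: algebra_simps, linarith+)
      then show ?thesis
        unfolding disjoint_family_on_def by (metis disjoint_iff)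
    qed
    have fin: "finite (I m)" and I1: "I m \<subseteq> {1..}" and card: "card (I m) = Suc K" for m
      by (auto simp: I_def)
    \<comment> \<open>Seen as a cylinder, the event is measurable and, for finite \<open>S\<close>,
      subject to the product formula.\<close>
    have box: "{x \<in> space ?M. \<forall>i\<in>S. x i \<in> A} = prod_emb {1..} (\<lambda>_. N) S (Pi\<^sub>E S (\<lambda>_. A))"
      for S :: "nat set"
      by (intro set_eqI) (simp add: prod_emb_iff space_PiM PiE_iff, blast)
    have prob_box: "prob {x \<in> space ?M. \<forall>i\<in>S. x i \<in> A} = measure N A ^ card S"
      if "finite S" "S \<subseteq> {1..}" for S
      unfolding box using that A by (subst measure_PiM_emb) auto
    have "indep_events (\<lambda>m. {x \<in> space ?M. \<forall>i\<in>I m. x i \<in> A}) UNIV"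
    proof (rule indep_eventsI)
      show "{x \<in> space ?M. \<forall>i\<in>I m. x i \<in> A} \<in> sets ?M" for m
        unfolding box using A fin I1 by (intro sets_PiM_I) auto
    next
      fix J :: "nat set" assume J: "finite J" "J \<noteq> {}"
      have "(\<Inter>m\<in>J. {x \<in> space ?M. \<forall>i\<in>I m. x i \<in> A}) = {x \<in> space ?M. \<forall>i\<in>(\<Union>m\<in>J. I m). x i \<in> A}"
        using J by auto
      moreover have "prob {x \<in> space ?M. \<forall>i\<in>(\<Union>m\<in>J. I m). x i \<in> A} = measure N A ^ card (\<Union>m\<in>J. I m)"
        using J fin I1 by (intro prob_box) (simp_all add: UN_subset_iff)
      moreover have "card (\<Union>m\<in>J. I m) = (\<Sum>m\<in>J. card (I m))"
        using I_disj J fin by (intro card_UN_disjoint) (auto simp: disjoint_family_on_def)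
      ultimately show "prob (\<Inter>m\<in>J. {x \<in> space ?M. \<forall>i\<in>I m. x i \<in> A})
          = (\<Prod>m\<in>J. prob {x \<in> space ?M. \<forall>i\<in>I m. x i \<in> A})"
        by (simp only: prob_box[OF fin I1] power_sum)
    qed
    then have "AE x in ?M. infinite {m. \<forall>i\<in>I m. x i \<in> A}"
      by (rule AE_infinitely_often_indep_events[where p="measure N A ^ Suc K"])
         (simp_all only: prob_box[OF fin I1] card order_refl zero_less_power A)
    then show ?thesis
    proof (rule AE_mp, intro AE_I2 impI)
      fix x assume "infinite {m. \<forall>i\<in>I m. x i \<in> A}"
      then have "infinite ((\<lambda>m. m * Suc K) ` {m. \<forall>i\<in>I m. x i \<in> A})"
        by (subst finite_image_iff) (auto simp: inj_on_def simp del: mult_Suc_right)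
      then show "infinite {n. \<forall>i\<in>{n+1..n+K}. x i \<in> A}"
        by (rule infinite_super[rotated]) (auto simp: I_def)
    qed
  qed
  then show ?thesis by (simp add: AE_all_countable)
qed

section \<open>Growth of a real exponential recursion\<close>

text \<open>Since \<open>b > 1 / exp 1\<close>, \<open>b * exp t\<close> exceeds \<open>t\<close> by
  a fixed amount, so a long run carries \<open>x\<close> past a threshold beyond which
  \<open>a * exp t \<ge> t + 1\<close>; from there on growth needs no further runs.\<close>

lemma exp_recursion_at_top:
  fixes x c :: "nat \<Rightarrow> real"
  assumes a: "a > 0" and b: "b > 1 / exp 1"
    and ge: "\<forall>\<^sub>F n in sequentially. a \<le> c n"
    and runs: "\<And>K. infinite {n. \<forall>i\<in>{n+1..n+K}. b \<le> c i}"
    and step: "\<forall>\<^sub>F n in sequentially. c (Suc n) * exp (x n) \<le> x (Suc n)"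
  shows "filterlim x at_top sequentially"
proof -
  \<comment> \<open>This is the minimum of \<open>b * exp t - t\<close>, attained at
    \<open>t = - ln b\<close>.\<close>
  define \<epsilon> where "\<epsilon> = 1 + ln b"
  have b0: "b > 0" using b by (smt (verit) divide_pos_pos exp_gt_zero)
  have "ln (1 / exp 1) < ln b" using b b0 by (subst ln_less_cancel_iff) auto
  then have \<epsilon>: "\<epsilon> > 0" by (simp add: \<epsilon>_def ln_div)
  have b_exp: "t + \<epsilon> \<le> b * exp t" for t
    using exp_ge_add_one_self[of "ln b + t"] b0 by (simp add: exp_add \<epsilon>_def)
  obtain n0 where n0: "\<And>n. n \<ge> n0 \<Longrightarrow> a \<le> c n" "\<And>n. n \<ge> n0 \<Longrightarrow> c (Suc n) * exp (x n) \<le> x (Suc n)"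
    using eventually_conj[OF ge step] by (auto simp: eventually_sequentially)
  have "\<forall>\<^sub>F t in at_top. t + 1 \<le> a * exp t" using a by real_asymp
  then obtain M0 where M0: "\<And>t. t \<ge> M0 \<Longrightarrow> t + 1 \<le> a * exp t"
    by (auto simp: eventually_at_top_linorder)
  obtain K :: nat where K: "M0 \<le> K * \<epsilon>"
    using reals_Archimedean3[OF \<epsilon>] by (auto intro: less_imp_le)
  obtain n where n: "n > n0" "\<And>i. i \<in> {n+1..n+K} \<Longrightarrow> b \<le> c i"
    using runs[of K] unfolding infinite_nat_iff_unbounded by blast
  \<comment> \<open>The strict \<open>n > n0\<close> provides a predecessor that forces
    \<open>x n\<close> to be nonnegative. This common starting level is why the run length
    \<open>K\<close> could be fixed before \<open>n\<close>.\<close>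
  have xn: "0 \<le> x n"
  proof -
    obtain m where m: "n = Suc m" "m \<ge> n0" using n(1) by (cases n) auto
    have "0 \<le> c n * exp (x m)" using n0(1)[of n] n(1) a by simp
    then show ?thesis using n0(2)[of m] m by simp
  qed
  have run: "j * \<epsilon> \<le> x (n + j)" if "j \<le> K" for j
    using that
  proof (induction j)
    case (Suc j)
    have "Suc j * \<epsilon> \<le> x (n + j) + \<epsilon>" using Suc by (simp add: algebra_simps)
    also have "\<dots> \<le> b * exp (x (n + j))" by (rule b_exp)
    also have "\<dots> \<le> c (Suc (n + j)) * exp (x (n + j))" using n(2) Suc.prems by simp
    also have "\<dots> \<le> x (n + Suc j)" using n0(2)[of "n + j"] n(1) by simp
    finally show ?case .
  qed (use xn in simp)
  have grow: "M0 + j \<le> x (n + K + j)" for j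
  proof (induction j)
    case 0
    show ?case using run[of K] K by simp
  next
    case (Suc j)
    have "M0 + Suc j \<le> x (n + K + j) + 1" using Suc by simp
    also have "\<dots> \<le> a * exp (x (n + K + j))" using M0 Suc by simp
    also have "\<dots> \<le> c (Suc (n + K + j)) * exp (x (n + K + j))"
      using n0(1)[of "Suc (n + K + j)"] n(1) by simp
    also have "\<dots> \<le> x (n + K + Suc j)" using n0(2)[of "n + K + j"] n(1) by simp
    finally show ?case .
  qed
  have "filterlim (\<lambda>j. M0 + real j) at_top sequentially" by real_asymp
  then have "filterlim (\<lambda>j. x (j + (n + K))) at_top sequentially"
    by (rule filterlim_at_top_mono) (use grow in \<open>simp add: add.commute\<close>)
  then show ?thesis
    by (simp add: filterlim_at_top eventually_sequentially_seg[where P="\<lambda>m. Z \<le> x m" for Z])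
qed

section \<open>Derivative bounds from imaginary parts\<close>

text \<open>The function \<open>exp (\<i> * (f w - f z))\<close> has modulus at most
  \<open>exp H\<close> on the disc and derivative \<open>\<i> * deriv f z\<close> at
  \<open>z\<close>; Cauchy's estimate on the circle of radius \<open>r/2\<close> gives the
  bound.\<close>

lemma deriv_bound_Im_bounded:
  assumes f: "f holomorphic_on ball z r" and r: "r > 0"
    and H: "\<And>w. w \<in> ball z r \<Longrightarrow> \<bar>Im (f w) - Im (f z)\<bar> \<le> H"
  shows "norm (deriv f z) \<le> 2 * exp H / r"
proof -
  define g where "g w = exp (\<i> * (f w - f z))" for w
  have sub: "cball z (r/2) \<subseteq> ball z r" using r by auto
  have g: "g holomorphic_on ball z r"
    unfolding g_def by (intro holomorphic_intros f)
  have g_le: "norm (g w) \<le> exp H" if "norm (z - w) = r/2" for w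
    using H[of w] that r by (simp add: g_def norm_exp_eq_Re dist_norm)
  have "norm ((deriv ^^ 1) g z) \<le> fact 1 * exp H / (r/2) ^ 1"
    by (rule Cauchy_inequality)
       (use g sub r g_le in \<open>auto intro: holomorphic_on_subset holomorphic_on_imp_continuous_on\<close>)
  moreover have "(f has_field_derivative deriv f z) (at z)"
    using f r by (intro holomorphic_derivI[of f "ball z r"]) auto
  then have "(g has_field_derivative \<i> * deriv f z) (at z)"
    unfolding g_def by (auto intro!: derivative_eq_intros)
  then have "deriv g z = \<i> * deriv f z" by (rule DERIV_imp_deriv)
  ultimately show ?thesis by (simp add: norm_mult field_simps)
qed

text \<open>A crude Schwarz--Pick inequality, with a constant that is not optimal: \<open>g\<close> below is the Cayley
  transform of \<open>f\<close>.\<close>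
lemma deriv_bound_Im_nonzero:
  assumes f: "f holomorphic_on ball z r" and r: "r > 0"
    and nz: "\<And>w. w \<in> ball z r \<Longrightarrow> Im (f w) \<noteq> 0"
  shows "norm (deriv f z) \<le> 4 * \<bar>Im (f z)\<bar> / r"
proof -
  define g where "g w = (f w - f z) / (f w - cnj (f z))" for w
  have sub: "cball z (r/2) \<subseteq> ball z r" using r by auto
  have zb: "z \<in> ball z r" using r by simp
  have same: "Im (f w) * Im (f z) > 0" if w: "w \<in> ball z r" for w
  proof (rule ccontr)
    assume *: "\<not> ?thesis"
    \<comment> \<open>The values of \<open>Im f\<close> form an interval avoiding 0, hence have one
      sign.\<close>
    have "connected ((\<lambda>w. Im (f w)) ` ball z r)"
      by (intro connected_continuous_image continuous_intros holomorphic_on_imp_continuous_on f) auto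
    moreover have "Im (f w) \<in> (\<lambda>w. Im (f w)) ` ball z r" "Im (f z) \<in> (\<lambda>w. Im (f w)) ` ball z r"
      using w zb by auto
    ultimately have "0 \<in> (\<lambda>w. Im (f w)) ` ball z r"
      using * unfolding connected_iff_interval
      by (metis linorder_le_cases mult_nonneg_nonneg mult_nonpos_nonpos nz[OF w] nz[OF zb]
          mult_eq_0_iff order_le_less)
    then show False using nz by auto
  qed
  have den: "f w - cnj (f z) \<noteq> 0" if "w \<in> ball z r" for w
  proof
    assume "f w - cnj (f z) = 0"
    then have "Im (f w) = - Im (f z)" by (simp add: complex_eq_iff)
    with same[OF that] show False by (simp add: mult_less_0_iff)
  qed
  have g: "g holomorphic_on ball z r"
    unfolding g_def using den by (intro holomorphic_intros f) auto
  have g_le: "norm (g w) \<le> 1" if "norm (z - w) = r/2" for w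
  proof -
    have w: "w \<in> ball z r" using that r by (simp add: dist_norm)
    \<comment> \<open>A point on the same side of the real axis as \<open>f z\<close> is at least as
      close to \<open>f z\<close> as to its mirror image.\<close>
    have "norm (f w - f z) \<le> norm (f w - cnj (f z))"
      using same[OF w] by (simp add: cmod_def power2_eq_square algebra_simps)
    then show ?thesis using den[OF w] by (simp add: g_def norm_divide divide_le_eq_1)
  qed
  have "norm ((deriv ^^ 1) g z) \<le> fact 1 * 1 / (r/2) ^ 1"
    by (rule Cauchy_inequality)
       (use g sub r g_le in \<open>auto intro: holomorphic_on_subset holomorphic_on_imp_continuous_on\<close>)
  moreover have "(f has_field_derivative deriv f z) (at z)"
    using f r by (intro holomorphic_derivI[of f "ball z r"]) auto
  then have "(g has_field_derivative deriv f z / (f z - cnj (f z))) (at z)"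
    unfolding g_def using den[OF zb] by (auto intro!: derivative_eq_intros)
  then have "deriv g z = deriv f z / (f z - cnj (f z))" by (rule DERIV_imp_deriv)
  moreover have "norm (f z - cnj (f z)) = 2 * \<bar>Im (f z)\<bar>"
    by (simp add: complex_diff_cnj norm_mult)
  ultimately show ?thesis using r nz[OF zb] by (simp add: norm_divide field_simps)
qed

section \<open>Odd multiples of pi, and the ratio of sine to its argument\<close>

lemma exists_Im_odd_multiple_pi:
  assumes S: "connected S" "continuous_on S f" and uv: "u \<in> S" "v \<in> S"
    and len: "Im (f v) - Im (f u) \<ge> 2 * pi"
  obtains w k where "w \<in> S" "Im (f w) = (2 * of_int k + 1) * pi"
proof -
  define t where "t = Im (f u) / pi"
  \<comment> \<open>This makes \<open>(2 * k + 1) * pi\<close> the first odd multiple of pi at or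
    above \<open>Im (f u)\<close>; the next \<open>2 * pi\<close> always contain one.\<close>
  define k where "k = \<lceil>(t - 1) / 2\<rceil>"
  have "real_of_int k - 1 < (t - 1) / 2 \<and> (t - 1) / 2 \<le> real_of_int k"
    unfolding k_def by (rule ceiling_correct)
  then have "t \<le> 2 * real_of_int k + 1 \<and> 2 * real_of_int k + 1 \<le> t + 2"
    by (simp add: field_simps)
  then have "Im (f u) \<le> (2 * k + 1) * pi" "(2 * k + 1) * pi \<le> Im (f u) + 2 * pi"
    by (simp_all add: t_def field_simps)
  moreover have "connected ((\<lambda>w. Im (f w)) ` S)"
    using S by (intro connected_continuous_image continuous_intros)
  ultimately have "(2 * k + 1) * pi \<in> (\<lambda>w. Im (f w)) ` S"
    using len uv unfolding connected_iff_interval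
    by (smt (verit) image_eqI)
  then show ?thesis using that[of _ k] by (auto simp: image_iff)
qed

text \<open>Halving the angle gives \<open>\<bar>sin y\<bar> \<le> \<bar>y\<bar> * \<bar>cos
  (y/2)\<bar>\<close>, which settles \<open>\<bar>y\<bar> < 2\<close>; for larger arguments
  \<open>\<bar>sin y\<bar> \<le> 1 \<le> \<bar>y\<bar> / 2\<close>. It serves to deduce that
  \<open>y\<close> tends to 0 once the ratio tends to 1.\<close>

lemma sin_ratio_bound:
  fixes \<eta> :: real
  assumes "0 < \<eta>" "\<eta> < 2"
  obtains q where "q < 1" "\<And>y. \<eta> \<le> \<bar>y\<bar> \<Longrightarrow> \<bar>sin y\<bar> \<le> q * \<bar>y\<bar>"
proof
  define q where "q = max (1/2) (cos (\<eta>/2))"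
  have "cos (\<eta>/2) < cos 0"
    using assms pi_gt3 by (intro cos_monotone_0_pi) auto
  then show "q < 1" by (simp add: q_def)
  fix y :: real assume y: "\<eta> \<le> \<bar>y\<bar>"
  show "\<bar>sin y\<bar> \<le> q * \<bar>y\<bar>"
  proof (cases "\<bar>y\<bar> < 2")
    case True
    have "\<bar>cos (y/2)\<bar> = cos (\<bar>y\<bar>/2)"
      using cos_ge_zero[of "\<bar>y\<bar>/2"] cos_abs_real[of "y/2"] True pi_gt3 by simp
    also have "\<dots> \<le> cos (\<eta>/2)"
      using True y assms pi_gt3 by (intro cos_monotone_0_pi_le) auto
    finally have q: "\<bar>cos (y/2)\<bar> \<le> q" by (simp add: q_def)
    have "\<bar>sin y\<bar> = 2 * \<bar>sin (y/2)\<bar> * \<bar>cos (y/2)\<bar>"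
      using sin_double[of "y/2"] by (simp add: abs_mult)
    also have "\<dots> \<le> \<bar>y\<bar> * q"
      using abs_sin_x_le_abs_x[of "y/2"] q by (intro mult_mono) auto
    finally show ?thesis by (simp add: mult.commute)
  next
    case False
    have "\<bar>sin y\<bar> \<le> 1/2 * \<bar>y\<bar>" using False abs_sin_le_one[of y] by linarith
    also have "\<dots> \<le> q * \<bar>y\<bar>" by (intro mult_right_mono) (auto simp: q_def)
    finally show ?thesis .
  qed
qed

section \<open>Orbit formulas and normality\<close>

text \<open>Each \<open>expmap c\<close> is its own derivative, so the chain rule multiplies the
  successive orbit points.\<close>

lemma compexp_has_field_derivative:
  "(compexp lam n has_field_derivative (\<Prod>k<n. compexp lam (Suc k) z)) (at z)"
proof (induction n)
  case 0
  show ?case by (simp add: id_def)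
next
  case (Suc n)
  have "((\<lambda>w. of_real (lam (Suc n)) * exp (compexp lam n w)) has_field_derivative
      of_real (lam (Suc n)) * (exp (compexp lam n z) * (\<Prod>k<n. compexp lam (Suc k) z))) (at z)"
    by (intro DERIV_cmult DERIV_fun_exp Suc)
  then show ?case by (simp add: expmap_def o_def mult_ac)
qed

lemma compexp_holomorphic_on: "compexp lam n holomorphic_on S"
  by (rule holomorphic_on_subset[OF _ subset_UNIV])
     (auto simp: holomorphic_on_open intro: compexp_has_field_derivative)

lemma deriv_compexp: "deriv (compexp lam n) z = (\<Prod>k<n. compexp lam (Suc k) z)"
  by (rule DERIV_imp_deriv) (rule compexp_has_field_derivative)

lemma Re_compexp_Suc:
  "Re (compexp lam (Suc n) z) = lam (Suc n) * cos (Im (compexp lam n z)) * exp (Re (compexp lam n z))"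
  by (simp add: expmap_def Re_exp)

lemma Im_compexp_Suc:
  "Im (compexp lam (Suc n) z) = lam (Suc n) * exp (Re (compexp lam n z)) * sin (Im (compexp lam n z))"
  by (simp add: expmap_def Im_exp)

lemma norm_compexp_Suc:
  "norm (compexp lam (Suc n) z) = \<bar>lam (Suc n)\<bar> * exp (Re (compexp lam n z))"
  by (simp add: expmap_def norm_mult)

text \<open>Escape at one point spreads over \<open>U\<close>: maps violating uniform escape on some
  compact set would have a convergent subsequence, whose limit can be neither finite at
  \<open>z\<close> nor infinity.\<close>

lemma normal_family_escape:
  assumes normal: "normal_family_on U {compexp lam n | n. n \<ge> 1}" and z: "z \<in> U"
    and esc: "filterlim (\<lambda>n. compexp lam n z) at_infinity sequentially"
  shows "loc_uniform_conv_infinity_on U (compexp lam)"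
  unfolding loc_uniform_conv_infinity_on_def
proof (intro allI impI, rule ccontr)
  fix K :: "complex set" and B :: real
  assume K: "compact K \<and> K \<subseteq> U"
    and not: "\<not> (\<forall>\<^sub>F n in sequentially. \<forall>w\<in>K. B < cmod (compexp lam n w))"
  \<comment> \<open>The condition \<open>1 \<le> n\<close> keeps the selected maps inside the
    family.\<close>
  define S where "S = {n. 1 \<le> n \<and> \<not> (\<forall>w\<in>K. B < cmod (compexp lam n w))}"
  have "infinite S"
    unfolding infinite_nat_iff_unbounded_le
  proof
    fix m
    obtain n where "n \<ge> max 1 m" "\<not> (\<forall>w\<in>K. B < cmod (compexp lam n w))"
      using not unfolding eventually_sequentially by blast
    then show "\<exists>n\<ge>m. n \<in> S" by (auto simp: S_def)
  qed
  define s where "s = enumerate S"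
  have s: "strict_mono s" "\<And>k. s k \<in> S"
    using \<open>infinite S\<close> by (auto simp: s_def strict_mono_enumerate enumerate_in_set)
  have "range (\<lambda>k. compexp lam (s k)) \<subseteq> {compexp lam n | n. n \<ge> 1}"
    using s(2) by (auto simp: S_def)
  with normal obtain r :: "nat \<Rightarrow> nat" where r: "strict_mono r" and conv:
    "(\<exists>g. loc_uniform_conv_on U ((\<lambda>k. compexp lam (s k)) \<circ> r) g) \<or>
      loc_uniform_conv_infinity_on U ((\<lambda>k. compexp lam (s k)) \<circ> r)"
    unfolding normal_family_on_def by blast
  from conv show False
  proof (elim disjE exE)
    fix g assume "loc_uniform_conv_on U ((\<lambda>k. compexp lam (s k)) \<circ> r) g"
    then have "compact {z} \<and> {z} \<subseteq> U \<longrightarrow> uniform_limit {z} ((\<lambda>k. compexp lam (s k)) \<circ> r) g sequentially"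
      unfolding loc_uniform_conv_on_def by (rule spec)
    then have "(\<lambda>k. compexp lam (s (r k)) z) \<longlonglongrightarrow> g z"
      using z by simp
    moreover have "filterlim (\<lambda>k. compexp lam (s (r k)) z) at_infinity sequentially"
      by (rule filterlim_compose[OF esc])
         (intro filterlim_compose[OF filterlim_subseq[OF s(1)]] filterlim_subseq r)
    ultimately show False
      using not_tendsto_and_filterlim_at_infinity sequentially_bot by blast
  next
    assume "loc_uniform_conv_infinity_on U ((\<lambda>k. compexp lam (s k)) \<circ> r)"
    then have "\<forall>\<^sub>F k in sequentially. \<forall>w\<in>K. B < cmod (compexp lam (s (r k)) w)"
      using K by (simp add: loc_uniform_conv_infinity_on_def)
    then obtain k where "\<forall>w\<in>K. B < cmod (compexp lam (s (r k)) w)"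
      by (auto simp: eventually_sequentially)
    then show False using s(2)[of "r k"] by (auto simp: S_def)
  qed
qed

section \<open>The deterministic argument\<close>

text \<open>These are the properties of a parameter sequence that hold almost surely; everything up
  to the end of the locale is free of probability.\<close>

locale escaping_parameters =
  fixes lam :: "nat \<Rightarrow> real" and a b B :: real
  assumes a_pos: "0 < a" and b_gt: "1 / exp 1 < b"
    and lam_bounds: "\<And>n. 1 \<le> n \<Longrightarrow> a \<le> lam n \<and> lam n \<le> B"
    and runs: "\<And>K. infinite {n. \<forall>i\<in>{n+1..n+K}. b \<le> lam i}"
begin

lemma lam_Suc_pos: "0 < lam (Suc n)"
  using lam_bounds[of "Suc n"] a_pos by auto

lemma compexp_Suc_nonzero: "compexp lam (Suc n) z \<noteq> 0"
  using lam_Suc_pos[of n] by (simp add: expmap_def)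

text \<open>The real parts obey the recursion of \<open>exp_recursion_at_top\<close> with
  coefficients \<open>lam\<close> times a cosine. The cosines tend to 1, so the runs survive with a
  slightly smaller bound.\<close>

lemma Re_at_top_if_Im_tendsto_0:
  assumes "(\<lambda>n. Im (compexp lam n z)) \<longlonglongrightarrow> 0"
  shows "filterlim (\<lambda>n. Re (compexp lam n z)) at_top sequentially"
proof -
  \<comment> \<open>The midpoint leaves room for the cosine factor while staying above
    \<open>1 / exp 1\<close>.\<close>
  define b' where "b' = (b + 1 / exp 1) / 2"
  have b': "1 / exp 1 < b'" "b' < b" using b_gt by (auto simp: b'_def)
  have e0: "0 < 1 / exp (1::real)" by simp
  have b0: "0 < b" "0 < b'" using e0 b' by linarith+
  define c where "c n = lam n * cos (Im (compexp lam (n - 1) z))" for n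
  have "(\<lambda>n. cos (Im (compexp lam n z))) \<longlonglongrightarrow> cos 0"
    using assms by (intro tendsto_intros)
  \<comment> \<open>The bound \<open>1/2\<close> keeps all late coefficients above
    \<open>a/2\<close>; \<open>b'/b\<close> keeps those in a run above \<open>b'\<close>.\<close>
  moreover have "max (1/2) (b'/b) < cos 0" using b' b0 by simp
  ultimately have "\<forall>\<^sub>F n in sequentially. max (1/2) (b'/b) < cos (Im (compexp lam n z))"
    by (rule order_tendstoD)
  then obtain n0 where n0: "\<And>n. n \<ge> n0 \<Longrightarrow> max (1/2) (b'/b) < cos (Im (compexp lam n z))"
    by (auto simp: eventually_sequentially)
  have cos_ge: "1/2 \<le> cos (Im (compexp lam (n - 1) z))" "b'/b \<le> cos (Im (compexp lam (n - 1) z))"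
    if "n \<ge> Suc n0" for n
    using n0[of "n - 1"] that by (auto simp: less_imp_le)
  show ?thesis
  proof (rule exp_recursion_at_top[where c = c])
    show "0 < a/2" using a_pos by simp
    show "1 / exp 1 < b'" by fact
    have "a/2 \<le> c n" if "n \<ge> Suc n0" for n
      using mult_mono[OF conjunct1[OF lam_bounds] cos_ge(1), of n n] that a_pos lam_bounds[of n]
      by (auto simp: c_def)
    then show "\<forall>\<^sub>F n in sequentially. a/2 \<le> c n"
      by (auto simp: eventually_sequentially)
    show "infinite {n. \<forall>i\<in>{n+1..n+K}. b' \<le> c i}" for K
    proof (rule infinite_super)
      show "infinite ({n. \<forall>i\<in>{n+1..n+K}. b \<le> lam i} - {..n0})"
        using runs by (rule Diff_infinite_finite[rotated]) simp
      have "b' \<le> c i" if "Suc n0 \<le> i" "b \<le> lam i" for i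
        using mult_mono[OF that(2) cos_ge(2)[of i]] that b0 by (auto simp: c_def)
      then show "{n. \<forall>i\<in>{n+1..n+K}. b \<le> lam i} - {..n0} \<subseteq> {n. \<forall>i\<in>{n+1..n+K}. b' \<le> c i}"
        by auto
    qed
    show "\<forall>\<^sub>F n in sequentially. c (Suc n) * exp (Re (compexp lam n z)) \<le> Re (compexp lam (Suc n) z)"
      by (simp only: c_def Re_compexp_Suc) simp
  qed
qed

lemma escape_if_Im_tendsto_0:
  assumes "(\<lambda>n. Im (compexp lam n z)) \<longlonglongrightarrow> 0"
  shows "filterlim (\<lambda>n. compexp lam n z) at_infinity sequentially"
  by (rule filterlim_norm_at_top_imp_at_infinity)
     (rule filterlim_at_top_mono[OF Re_at_top_if_Im_tendsto_0[OF assms]],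
      auto intro: always_eventually complex_Re_le_cmod)

text \<open>The derivative is a product of nonzero orbit points, which eventually have modulus at
  least 2, so it grows at least geometrically.\<close>

lemma deriv_compexp_at_infinity:
  assumes "filterlim (\<lambda>n. compexp lam n z) at_infinity sequentially"
  shows "filterlim (\<lambda>n. norm (deriv (compexp lam n) z)) at_top sequentially"
proof -
  have "\<forall>\<^sub>F n in sequentially. 2 \<le> norm (compexp lam n z)"
    using filterlim_at_infinity_imp_norm_at_top[OF assms] by (simp add: filterlim_at_top)
  then obtain n0 where n0: "\<And>n. n \<ge> n0 \<Longrightarrow> 2 \<le> norm (compexp lam n z)"
    by (auto simp: eventually_sequentially)
  define C where "C = norm (\<Prod>k<n0. compexp lam (Suc k) z)"
  have C: "C > 0" using compexp_Suc_nonzero by (simp add: C_def del: compexp.simps)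
  have "C * 2 ^ n \<le> norm (deriv (compexp lam (n + n0)) z)" for n
  proof (induction n)
    case 0
    show ?case by (simp add: C_def deriv_compexp)
  next
    case (Suc n)
    have "C * 2 ^ Suc n = (C * 2 ^ n) * 2" by simp
    also have "\<dots> \<le> norm (deriv (compexp lam (n + n0)) z) * norm (compexp lam (Suc (n + n0)) z)"
      using Suc n0[of "Suc (n + n0)"] by (intro mult_mono) auto
    also have "\<dots> = norm (deriv (compexp lam (Suc n + n0)) z)"
      by (simp only: deriv_compexp norm_mult[symmetric] add_Suc prod.lessThan_Suc)
    finally show ?case .
  qed
  moreover have "filterlim (\<lambda>n. C * 2 ^ n) at_top sequentially" using C by real_asymp
  ultimately have "filterlim (\<lambda>n. norm (deriv (compexp lam (n + n0)) z)) at_top sequentially"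
    by (auto intro: filterlim_at_top_mono always_eventually)
  then show ?thesis
    by (simp add: filterlim_at_top
        eventually_sequentially_seg[where P="\<lambda>m. Z \<le> norm (deriv (compexp lam m) z)" for Z])
qed

text \<open>Here the cosine is -1, so the next point has negative real part and the following
  exponential is at most 1.\<close>

lemma norm_compexp_after_negative_axis:
  assumes "Im (compexp lam n w) = (2 * of_int k + 1) * pi"
  shows "norm (compexp lam (Suc (Suc n)) w) \<le> B"
proof -
  have "cos ((2 * of_int k + 1) * pi) = -1"
    by (metis cos_periodic_pi cos_int_2pin add.commute distrib_right mult.assoc mult.commute mult_1)
  then have "Re (compexp lam (Suc n) w) \<le> 0"
    using lam_Suc_pos[of n] assms by (simp only: Re_compexp_Suc) simp
  then have "\<bar>lam (Suc (Suc n))\<bar> * exp (Re (compexp lam (Suc n) w)) \<le> B * 1"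
    using lam_bounds[of "Suc (Suc n)"] lam_Suc_pos[of "Suc n"] by (intro mult_mono) auto
  then show ?thesis by (simp only: norm_compexp_Suc mult_1_right)
qed

lemma not_loc_uniform_escape:
  assumes r: "r > 0" and sub: "cball z r \<subseteq> U"
    and esc: "loc_uniform_conv_infinity_on U (compexp lam)"
  shows False
proof -
  have unif: "\<forall>\<^sub>F n in sequentially. \<forall>w\<in>cball z r. R < norm (compexp lam n w)" for R
    using esc sub unfolding loc_uniform_conv_infinity_on_def by (meson compact_cball)
  have "\<forall>\<^sub>F n in sequentially. R < norm (compexp lam n z)" for R
    using unif[of R] by eventually_elim (use r in auto)
  then have "filterlim (\<lambda>n. compexp lam n z) at_infinity sequentially"
    by (intro filterlim_norm_at_top_imp_at_infinity) (simp add: filterlim_at_top_dense)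
  then have "filterlim (\<lambda>n. norm (deriv (compexp lam n) z)) at_top sequentially"
    by (rule deriv_compexp_at_infinity)
  then have "\<forall>\<^sub>F n in sequentially. norm (deriv (compexp lam n) z) > 2 * exp (2 * pi) / r"
    by (simp add: filterlim_at_top_dense)
  \<comment> \<open>The shift by 2 matches the two steps after which
    \<open>norm_compexp_after_negative_axis\<close> bounds the orbit.\<close>
  moreover have "\<forall>\<^sub>F n in sequentially. \<forall>w\<in>cball z r. B < norm (compexp lam (n + 2) w)"
    using unif[of B] by (rule sequentially_offset)
  ultimately have "\<forall>\<^sub>F n in sequentially. norm (deriv (compexp lam n) z) > 2 * exp (2 * pi) / r
      \<and> (\<forall>w\<in>cball z r. B < norm (compexp lam (n + 2) w))"
    by (rule eventually_conj)
  then obtain n where n: "norm (deriv (compexp lam n) z) > 2 * exp (2 * pi) / r"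
      "\<forall>w\<in>cball z r. B < norm (compexp lam (n + 2) w)"
    by (auto simp: eventually_sequentially)
  obtain w where w: "w \<in> ball z r" "\<bar>Im (compexp lam n w) - Im (compexp lam n z)\<bar> > 2 * pi"
  proof (rule ccontr)
    assume "\<not> thesis"
    then have "norm (deriv (compexp lam n) z) \<le> 2 * exp (2 * pi) / r"
      using that by (intro deriv_bound_Im_bounded compexp_holomorphic_on r) force
    then show False using n(1) by simp
  qed
  \<comment> \<open>Take \<open>z\<close> and \<open>w\<close>, in the order of their imaginary
    parts.\<close>
  have "\<exists>u\<in>ball z r. \<exists>v\<in>ball z r. Im (compexp lam n v) - Im (compexp lam n u) \<ge> 2 * pi"
    using w r by (smt (verit) centre_in_ball)
  then obtain u v where uv: "u \<in> ball z r" "v \<in> ball z r"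
      "Im (compexp lam n v) - Im (compexp lam n u) \<ge> 2 * pi" by blast
  obtain w' k where "w' \<in> ball z r" "Im (compexp lam n w') = (2 * of_int k + 1) * pi"
    by (rule exists_Im_odd_multiple_pi[OF _ _ uv])
       (auto intro: holomorphic_on_imp_continuous_on compexp_holomorphic_on)
  then show False
    using norm_compexp_after_negative_axis[of n w' k] bspec[OF n(2), of w'] by simp
qed

lemma Im_tendsto_0_if_never_real:
  assumes r: "r > 0" and nz: "\<And>w n. w \<in> ball z r \<Longrightarrow> Im (compexp lam n w) \<noteq> 0"
  shows "(\<lambda>n. Im (compexp lam n z)) \<longlonglongrightarrow> 0"
proof -
  define y where "y n = Im (compexp lam n z)" for n
  \<comment> \<open>Up to normalisation, this is the hyperbolic density of a half-plane pulled back
    to \<open>z\<close> by \<open>compexp lam n\<close>.\<close>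
  define P where "P n = norm (deriv (compexp lam n) z) / \<bar>y n\<bar>" for n
  have y: "y n \<noteq> 0" for n using nz[of z n] r by (simp add: y_def)
  have P_le: "P n \<le> 4 / r" for n
  proof -
    have "norm (deriv (compexp lam n) z) \<le> 4 * \<bar>y n\<bar> / r"
      unfolding y_def using nz by (intro deriv_bound_Im_nonzero compexp_holomorphic_on r)
    then show ?thesis using y[of n] by (simp add: P_def field_simps)
  qed
  \<comment> \<open>Derivative and imaginary part both acquire the factor
    \<open>norm (compexp lam (Suc n) z)\<close>, which cancels in the quotient.\<close>
  have P_Suc: "P (Suc n) * \<bar>sin (y n)\<bar> = P n * \<bar>y n\<bar>" for n
  proof -
    have "deriv (compexp lam (Suc n)) z = deriv (compexp lam n) z * compexp lam (Suc n) z"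
      by (simp only: deriv_compexp prod.lessThan_Suc)
    moreover have "\<bar>y (Suc n)\<bar> = norm (compexp lam (Suc n) z) * \<bar>sin (y n)\<bar>"
      by (simp only: y_def Im_compexp_Suc norm_compexp_Suc abs_mult abs_exp_cancel)
    moreover have "norm (compexp lam (Suc n) z) \<noteq> 0" "sin (y n) \<noteq> 0"
      using y[of "Suc n"] calculation(2) by auto
    ultimately show ?thesis using y[of n] by (simp add: P_def norm_mult field_simps)
  qed
  have P_pos: "P n > 0" for n
    using y[of n] compexp_Suc_nonzero by (simp add: P_def deriv_compexp del: compexp.simps)
  have P_inc: "P n \<le> P (Suc n)" for n
  proof -
    have "P n * \<bar>y n\<bar> \<le> P (Suc n) * \<bar>y n\<bar>"
      using P_Suc[of n] P_pos[of "Suc n"] abs_sin_x_le_abs_x[of "y n"]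
      by (metis less_imp_le mult_left_mono)
    then show ?thesis using y[of n] by simp
  qed
  have "incseq P" by (rule incseq_SucI) (rule P_inc)
  then obtain L where L: "P \<longlonglongrightarrow> L" "\<And>n. P n \<le> L"
    using incseq_convergent[of P "4 / r"] P_le by blast
  have L_pos: "L > 0" using L(2)[of 0] P_pos[of 0] by simp
  have ratio: "(\<lambda>n. P n / P (Suc n)) \<longlonglongrightarrow> 1"
    using tendsto_divide[OF L(1) LIMSEQ_Suc[OF L(1)]] L_pos by simp
  have "(\<lambda>n. y n) \<longlonglongrightarrow> 0"
  proof (rule LIMSEQ_I)
    fix e :: real assume e: "0 < e"
    \<comment> \<open>Capping at 1 meets the requirement \<open>\<eta> < 2\<close> of
      \<open>sin_ratio_bound\<close>.\<close>
    define \<eta> where "\<eta> = min e 1"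
    obtain q where q: "q < 1" "\<And>t. \<eta> \<le> \<bar>t\<bar> \<Longrightarrow> \<bar>sin t\<bar> \<le> q * \<bar>t\<bar>"
      by (rule sin_ratio_bound[of \<eta>]) (use e in \<open>auto simp: \<eta>_def\<close>)
    have "\<forall>\<^sub>F n in sequentially. q < P n / P (Suc n)"
      using ratio q(1) by (rule order_tendstoD)
    then obtain n0 where n0: "\<And>n. n \<ge> n0 \<Longrightarrow> q < P n / P (Suc n)"
      by (auto simp: eventually_sequentially)
    have "\<bar>y n\<bar> < \<eta>" if "n \<ge> n0" for n
    proof (rule ccontr)
      assume "\<not> \<bar>y n\<bar> < \<eta>"
      then have "P n * \<bar>y n\<bar> \<le> P (Suc n) * (q * \<bar>y n\<bar>)"
        using q(2)[of "y n"] P_Suc[of n] P_pos[of "Suc n"] by (metis less_imp_le mult_left_mono not_less)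
      then have "P n \<le> P (Suc n) * q" using y[of n] by (simp add: mult.assoc[symmetric])
      moreover have "q * P (Suc n) < P n"
        using n0[OF that] P_pos[of "Suc n"] by (simp add: pos_less_divide_eq)
      ultimately show False by (simp add: mult.commute)
    qed
    then show "\<exists>no. \<forall>n\<ge>no. norm (y n - 0) < e"
      by (intro exI[of _ n0]) (auto simp: \<eta>_def)
  qed
  then show ?thesis by (simp add: y_def)
qed

theorem julia_set_eq_UNIV: "julia_set lam = UNIV"
proof -
  have False if "z \<in> fatou_set lam" for z
  proof -
    from that obtain U where U: "open U" "z \<in> U" "normal_family_on U {compexp lam n | n. n \<ge> 1}"
      by (auto simp: fatou_set_def)
    then obtain r where r: "r > 0" "cball z r \<subseteq> U"
      by (meson open_contains_cball)
    have no_escape: "\<not> (\<lambda>n. Im (compexp lam n w)) \<longlonglongrightarrow> 0" if "w \<in> ball z r" for w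
    proof
      assume "(\<lambda>n. Im (compexp lam n w)) \<longlonglongrightarrow> 0"
      moreover have "w \<in> U" using that r by (meson ball_subset_cball subsetD)
      ultimately have "loc_uniform_conv_infinity_on U (compexp lam)"
        using U(3) by (intro normal_family_escape[of U lam w] escape_if_Im_tendsto_0)
      then show False using r not_loc_uniform_escape by blast
    qed
    have "Im (compexp lam n w) \<noteq> 0" if "w \<in> ball z r" for w n
    proof
      assume n: "Im (compexp lam n w) = 0"
      \<comment> \<open>A real orbit point stays real, so the imaginary parts tend to 0
        trivially.\<close>
      have "Im (compexp lam (m + n) w) = 0" for m
        by (induction m) (simp_all only: n add_0 add_Suc Im_compexp_Suc sin_zero mult_zero_right)
      then have "(\<lambda>m. Im (compexp lam (m + n) w)) \<longlonglongrightarrow> 0" by simp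
      then show False using no_escape[OF that] by (auto dest: LIMSEQ_offset)
    qed
    then show False
      using Im_tendsto_0_if_never_real[OF r(1)] no_escape[of z] r(1) by auto
  qed
  then show ?thesis by (auto simp: julia_set_def)
qed

end

section \<open>Almost every sequence satisfies the deterministic conditions\<close>

theorem theorem3p2:
  fixes \<delta> :: real
  assumes "0 < \<delta>" and "\<delta> < 1 / exp 1"
  shows "AE lam in (\<Pi>\<^sub>M n\<in>{1::nat..}. uniform_measure lborel {1 / exp 1 - \<delta> <..< 1 / exp 1 + \<delta>}).
           julia_set lam = UNIV"
proof -
  let ?I = "{1 / exp 1 - \<delta> <..< 1 / exp 1 + \<delta>}"
  let ?N = "uniform_measure lborel ?I"
  \<comment> \<open>The top quarter of \<open>?I\<close>: it has positive probability and stays away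
    from \<open>1 / exp 1\<close>.\<close>
  let ?A = "{1 / exp 1 + \<delta>/2 <..< 1 / exp 1 + \<delta>}"
  have N: "prob_space ?N"
    using assms by (intro prob_space_uniform_measure) auto
  have "?I \<inter> ?A = ?A" using assms by auto
  then have "measure ?N ?A > 0"
    using assms by (subst measure_uniform_measure) (auto simp: field_simps)
  then have runs: "AE lam in (\<Pi>\<^sub>M n\<in>{1::nat..}. ?N). \<forall>K. infinite {n. \<forall>i\<in>{n+1..n+K}. lam i \<in> ?A}"
    by (intro AE_PiM_infinitely_many_runs N) auto
  \<comment> \<open>The measure \<open>?N\<close> lives on the whole real line, so membership in
    \<open>?I\<close> holds only almost everywhere and is transferred to all coordinates.\<close>
  have "AE t in ?N. t \<in> ?I" by (rule AE_uniform_measureI) auto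
  then have "AE lam in (\<Pi>\<^sub>M n\<in>{1::nat..}. ?N). lam n \<in> ?I" if "n \<in> {1..}" for n
    using N that by (intro AE_PiM_component[where M="\<lambda>_. ?N"])
  then have "AE lam in (\<Pi>\<^sub>M n\<in>{1::nat..}. ?N). \<forall>n\<in>{1..}. lam n \<in> ?I"
    by (intro AE_ball_countable') auto
  with runs show ?thesis
  proof eventually_elim
    case (elim lam)
    \<comment> \<open>The assumption \<open>\<delta> < 1 / exp 1\<close> makes the lower bound
      \<open>a\<close> positive.\<close>
    interpret escaping_parameters lam "1 / exp 1 - \<delta>" "1 / exp 1 + \<delta>/2" "1 / exp 1 + \<delta>"
    proof
      show "infinite {n. \<forall>i\<in>{n+1..n+K}. 1 / exp 1 + \<delta>/2 \<le> lam i}" for K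
        by (rule infinite_super[OF _ elim(1)[rule_format, of K]]) force
    qed (use assms elim(2) in force)+
    show ?case by (rule julia_set_eq_UNIV)
  qed
qed

end
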